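(* Let $1\le r\le s$, let $A\in\mathbb{C}_r^{m\times n}$ and $\widetilde A\in\mathbb{C}_s^{m\times n}$ have generalized polar decompositions $A=QH$ and $\widetilde A=\widetilde Q\widetilde H$, and let $\sigma_1\ge\dots\ge\sigma_r>0$ and $\widetilde\sigma_1\ge\dots\ge\widetilde\sigma_s>0$ be the nonzero singular values of $A$ and $\widetilde A$. Put $F_{r,s}:=\sum_{j=1}^r\sigma_j^2+\sum_{j=1}^s\widetilde\sigma_j^2$ and $G_{r,r}:=\sum_{j=1}^r\sigma_j\widetilde\sigma_j$. Then $$\|A+\widetilde A\|_F\ge\sqrt{\frac{F_{r,s}-2G_{r,r}}{F_{r,s}+2G_{r,r}}}\;\|H+\widetilde H\|_F .$$ Moreover the coefficient of $\|H+\widetilde H\|_F$ is optimal: for given $m,n$ and given $\sigma_1\ge\dots\ge\sigma_r>0$, $\widetilde\sigma_1\ge\dots\ge\widetilde\sigma_s>0$ with $s\le\min(m,n)$, it cannot be replaced by any larger number so that the inequality still holds for all $A\in\mathbb{C}_r^{m\times n}$, $\widetilde A\in\mathbb{C}_s^{m\times n}$ with these nonzero singular values.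
   Context: $\mathbb{C}^{m\times n}_r$ denotes the set of complex $m\times n$ matrices of rank $r$; $\|\cdot\|_F$ is the Frobenius norm. For $A\in\mathbb{C}_r^{m\times n}$, the generalized polar decomposition is $A=QH$ with $Q\in\mathbb{C}_r^{m\times n}$ subunitary (a partial isometry) and $H\in\mathbb{C}_r^{n\times n}$ positive semidefinite, subject to $\mathcal R(Q^* )=\mathcal R(H)$ (column spaces), which makes it unique; in fact $H=|A|:=(A^*A)^{1/2}$. $Q$ is the subunitary polar factor and $H$ the positive polar factor. *)

theory Defs
  imports Complex_Main "Jordan_Normal_Form.DL_Rank" "Jordan_Normal_Form.Schur_Decomposition"
begin

definition rank_mats :: "nat \<Rightarrow> nat \<Rightarrow> nat \<Rightarrow> complex mat set" where
  "rank_mats r m n = {A \<in> carrier_mat m n. vec_space.rank m A = r}"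

definition frobenius_norm :: "complex mat \<Rightarrow> real" where
  "frobenius_norm A = sqrt (\<Sum>i<dim_row A. \<Sum>j<dim_col A. (cmod (A $$ (i, j)))\<^sup>2)"

definition column_range :: "complex mat \<Rightarrow> complex vec set" where
  "column_range A = vec_space.col_space (dim_row A) A"

text \<open>The order on \<^typ>\<open>complex\<close> is the one of Complex-Order: \<open>0 \<le> z\<close> says that \<open>z\<close> is
  real and nonnegative.\<close>

definition positive_semidefinite :: "complex mat \<Rightarrow> bool" where
  "positive_semidefinite H \<longleftrightarrow>
     square_mat H \<and> mat_adjoint H = H \<and>
     (\<forall>x \<in> carrier_vec (dim_col H). 0 \<le> (H *\<^sub>v x) \<bullet>c x)"

text \<open>A subunitary matrix (partial isometry) \<open>Q\<close> preserves the Euclidean norm on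
  \<open>R(Q\<^sup>*)\<close>, the orthogonal complement of its kernel; \<open>v \<bullet>c v\<close> is the squared norm of \<open>v\<close>.\<close>

definition subunitary :: "complex mat \<Rightarrow> bool" where
  "subunitary Q \<longleftrightarrow>
     (\<forall>x \<in> column_range (mat_adjoint Q). (Q *\<^sub>v x) \<bullet>c (Q *\<^sub>v x) = x \<bullet>c x)"

definition generalized_polar_decomposition ::
  "nat \<Rightarrow> nat \<Rightarrow> nat \<Rightarrow> complex mat \<Rightarrow> complex mat \<Rightarrow> complex mat \<Rightarrow> bool" where
  "generalized_polar_decomposition r m n A Q H \<longleftrightarrow>
     A \<in> rank_mats r m n \<and> Q \<in> rank_mats r m n \<and> H \<in> rank_mats r n n \<and>
     A = Q * H \<and> subunitary Q \<and> positive_semidefinite H \<and>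
     column_range (mat_adjoint Q) = column_range H"

text \<open>The positive square roots of the nonzero eigenvalues of \<open>A\<^sup>* A\<close>, counted with
  multiplicity. These eigenvalues are real and positive, so \<^const>\<open>Re\<close> loses nothing.\<close>

definition nonzero_singular_values :: "complex mat \<Rightarrow> real multiset" where
  "nonzero_singular_values A =
     image_mset (\<lambda>z. sqrt (Re z))
       (filter_mset (\<lambda>z. z \<noteq> 0) (proots (char_poly (mat_adjoint A * A))))"

text \<open>Lists of prescribed singular values are functions of the indices \<open>1, \<dots>, r\<close>; values at
  other indices are irrelevant.\<close>

definition decreasing_positive :: "nat \<Rightarrow> (nat \<Rightarrow> real) \<Rightarrow> bool" where
  "decreasing_positive r \<sigma> \<longleftrightarrow>
     (\<forall>j \<in> {1..r}. 0 < \<sigma> j) \<and> (\<forall>i \<in> {1..r}. \<forall>j \<in> {1..r}. i \<le> j \<longrightarrow> \<sigma> j \<le> \<sigma> i)"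

definition has_nonzero_singular_values :: "complex mat \<Rightarrow> nat \<Rightarrow> (nat \<Rightarrow> real) \<Rightarrow> bool" where
  "has_nonzero_singular_values A r \<sigma> \<longleftrightarrow>
     nonzero_singular_values A = image_mset \<sigma> (mset_set {1..r})"

definition F_sum :: "nat \<Rightarrow> nat \<Rightarrow> (nat \<Rightarrow> real) \<Rightarrow> (nat \<Rightarrow> real) \<Rightarrow> real" where
  "F_sum r s \<sigma> \<tau> = (\<Sum>j=1..r. (\<sigma> j)\<^sup>2) + (\<Sum>j=1..s. (\<tau> j)\<^sup>2)"

definition G_sum :: "nat \<Rightarrow> (nat \<Rightarrow> real) \<Rightarrow> (nat \<Rightarrow> real) \<Rightarrow> real" where
  "G_sum r \<sigma> \<tau> = (\<Sum>j=1..r. \<sigma> j * \<tau> j)"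

definition polar_coefficient :: "nat \<Rightarrow> nat \<Rightarrow> (nat \<Rightarrow> real) \<Rightarrow> (nat \<Rightarrow> real) \<Rightarrow> real" where
  "polar_coefficient r s \<sigma> \<tau> =
     sqrt ((F_sum r s \<sigma> \<tau> - 2 * G_sum r \<sigma> \<tau>) / (F_sum r s \<sigma> \<tau> + 2 * G_sum r \<sigma> \<tau>))"

end

theory Submission
  imports Defs
begin

text \<open>
  Write \<open>\<langle>A, B\<rangle>\<close> for the Frobenius inner product. Since \<open>\<parallel>A\<parallel>\<^sup>2\<close> is the sum of the squared
  singular values and \<open>A\<close>, \<open>H\<close> share their singular values (a partial isometry preserves norms
  on the range of \<open>H\<close>, so \<open>A\<^sup>*A = H\<^sup>*H\<close> by polarization),
  \<open>\<parallel>A + A'\<parallel>\<^sup>2 = F + 2 Re \<langle>A, A'\<rangle>\<close> and \<open>\<parallel>H + H'\<parallel>\<^sup>2 = F + 2 Re \<langle>H, H'\<rangle>\<close>.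
  Both inner products are bounded in modulus by \<open>G\<close>, by von Neumann's trace inequality. So the
  first norm squared is at least \<open>F - 2G\<close> and the second at most \<open>F + 2G\<close>; the two estimates are
  made independently and their quotient is the asserted coefficient. Nothing is lost, because
  the two bounds are attained together: take \<open>A\<close> diagonal with entries \<open>\<sigma>\<^sub>j\<close> and \<open>A'\<close> diagonal with
  entries \<open>-\<tau>\<^sub>j\<close>, whose positive polar factors are diagonal with entries \<open>\<sigma>\<^sub>j\<close> and \<open>\<tau>\<^sub>j\<close>.

  Von Neumann's inequality is proved from singular value decompositions
  \<open>A = \<Sum>\<^sub>k \<sigma>\<^sub>k u\<^sub>k v\<^sub>k\<^sup>*\<close> and \<open>B = \<Sum>\<^sub>l \<tau>\<^sub>l x\<^sub>l y\<^sub>l\<^sup>*\<close>. The inner product becomes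
  \<open>\<Sum>\<^sub>k\<^sub>l \<sigma>\<^sub>k \<tau>\<^sub>l \<langle>u\<^sub>k, x\<^sub>l\<rangle> \<langle>y\<^sub>l, v\<^sub>k\<rangle>\<close>, and the arithmetic-geometric mean inequality bounds the product of
  overlaps by \<open>D\<^sub>k\<^sub>l = (|\<langle>u\<^sub>k, x\<^sub>l\<rangle>|\<^sup>2 + |\<langle>y\<^sub>l, v\<^sub>k\<rangle>|\<^sup>2) / 2\<close>. Bessel's inequality makes \<open>D\<close> doubly
  substochastic, and among doubly substochastic weights the sum is largest for the partial
  identity, because both sequences decrease; there it equals \<open>G\<close>. The decomposition
  itself comes from diagonalizing the Hermitian matrix \<open>A\<^sup>*A\<close> with its eigenvalues in a prescribed
  order.
\<close>

section \<open>Weighted sums with doubly substochastic weights\<close>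

text \<open>Summation by parts: replacing \<open>\<sigma>\<^sub>p\<close> by the smaller \<open>\<sigma>\<^bsub>p+1\<^esub>\<close> in front of a nonnegative partial sum
  only decreases it, so \<open>\<sigma>\<^sub>p\<close> times the \<open>p\<close>-th partial sum stays below the weighted sum.\<close>

lemma abel_sum_nonneg:
  fixes x \<sigma> :: "nat \<Rightarrow> real"
  assumes "decreasing_positive r \<sigma>"
    and partial: "\<And>p. p \<le> r \<Longrightarrow> 0 \<le> (\<Sum>k=1..p. x k)"
  shows "0 \<le> (\<Sum>k=1..r. \<sigma> k * x k)"
proof -
  have dec: "\<And>i j. 1 \<le> i \<Longrightarrow> i \<le> j \<Longrightarrow> j \<le> r \<Longrightarrow> \<sigma> j \<le> \<sigma> i"
    and pos: "\<And>j. 1 \<le> j \<Longrightarrow> j \<le> r \<Longrightarrow> 0 < \<sigma> j"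
    using assms(1) by (auto simp: decreasing_positive_def)
  have "\<sigma> p * (\<Sum>k=1..p. x k) \<le> (\<Sum>k=1..p. \<sigma> k * x k)" if "1 \<le> p" "p \<le> r" for p
    using that
  proof (induction p rule: nat_induct_at_least)
    case base
    then show ?case by simp
  next
    case (Suc p)
    have "\<sigma> (Suc p) * (\<Sum>k=1..p. x k) \<le> \<sigma> p * (\<Sum>k=1..p. x k)"
      using Suc by (intro mult_right_mono dec partial) auto
    with Suc show ?case by (simp add: algebra_simps)
  qed
  note weighted = this
  show ?thesis
  proof (cases "1 \<le> r")
    case True
    then have "0 \<le> \<sigma> r * (\<Sum>k=1..r. x k)"
      using pos[of r] partial[of r] by (intro mult_nonneg_nonneg) auto
    also note weighted[OF True order_refl]
    finally show ?thesis .
  qed simp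
qed

text \<open>The fractional knapsack principle: a budget \<open>p\<close>, of which at most one unit may go to each item,
  is best spent on the \<open>p\<close> largest items. All values are compared with the threshold \<open>\<tau>\<^sub>p\<close>: the weight
  placed beyond \<open>p\<close> earns at most \<open>\<tau>\<^sub>p\<close> per unit, and the weight missing up to \<open>p\<close> costs at least that.\<close>

lemma fractional_selection_le_top_sum:
  fixes d \<tau> :: "nat \<Rightarrow> real"
  assumes "decreasing_positive s \<tau>" and "p \<le> s"
    and d: "\<And>l. l \<in> {1..s} \<Longrightarrow> 0 \<le> d l \<and> d l \<le> 1" and total: "(\<Sum>l=1..s. d l) \<le> real p"
  shows "(\<Sum>l=1..s. \<tau> l * d l) \<le> (\<Sum>l=1..p. \<tau> l)"
proof (cases "p = 0")
  case True
  then have "(\<Sum>l=1..s. d l) = 0"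
    using total d by (intro antisym sum_nonneg) auto
  then have "\<forall>l\<in>{1..s}. d l = 0"
    using d by (subst (asm) sum_nonneg_eq_0_iff) auto
  then show ?thesis using True by simp
next
  case False
  have dec: "\<And>i j. 1 \<le> i \<Longrightarrow> i \<le> j \<Longrightarrow> j \<le> s \<Longrightarrow> \<tau> j \<le> \<tau> i"
    and pos: "\<And>j. 1 \<le> j \<Longrightarrow> j \<le> s \<Longrightarrow> 0 < \<tau> j"
    using assms(1) by (auto simp: decreasing_positive_def)
  have split: "(\<Sum>l=1..s. f l) = (\<Sum>l=1..p. f l) + (\<Sum>l=p+1..s. f l)" for f :: "nat \<Rightarrow> real"
    using sum.ub_add_nat[of 1 p f "s - p"] \<open>p \<le> s\<close> by simp
  have "(\<Sum>l=p+1..s. \<tau> l * d l) \<le> (\<Sum>l=p+1..s. \<tau> p * d l)"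
    using False d by (intro sum_mono mult_right_mono dec) auto
  also have "\<dots> = \<tau> p * (\<Sum>l=p+1..s. d l)" by (simp add: sum_distrib_left)
  also have "\<dots> \<le> \<tau> p * (real p - (\<Sum>l=1..p. d l))"
    using total pos[of p] False \<open>p \<le> s\<close> unfolding split[of d] by (intro mult_left_mono) auto
  also have "\<dots> = (\<Sum>l=1..p. \<tau> p * (1 - d l))"
    by (simp add: sum_subtractf sum_distrib_left[symmetric] algebra_simps)
  also have "\<dots> \<le> (\<Sum>l=1..p. \<tau> l * (1 - d l))"
    using \<open>p \<le> s\<close> d by (intro sum_mono mult_right_mono dec) auto
  finally show ?thesis
    unfolding split[of "\<lambda>l. \<tau> l * d l"] by (simp add: sum_subtractf algebra_simps)
qed

text \<open>By summation by parts in \<open>k\<close> it suffices to compare the sums over \<open>k \<le> p\<close>. There the column sums of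
  the first \<open>p\<close> rows of \<open>D\<close> are fractional weights of total at most \<open>p\<close>.\<close>

lemma doubly_substochastic_bound:
  fixes D :: "nat \<Rightarrow> nat \<Rightarrow> real"
  assumes \<sigma>: "decreasing_positive r \<sigma>" and \<tau>: "decreasing_positive s \<tau>" and "r \<le> s"
    and D: "\<And>k l. k \<in> {1..r} \<Longrightarrow> l \<in> {1..s} \<Longrightarrow> 0 \<le> D k l"
    and rows: "\<And>k. k \<in> {1..r} \<Longrightarrow> (\<Sum>l=1..s. D k l) \<le> 1"
    and cols: "\<And>l. l \<in> {1..s} \<Longrightarrow> (\<Sum>k=1..r. D k l) \<le> 1"
  shows "(\<Sum>k=1..r. \<Sum>l=1..s. \<sigma> k * \<tau> l * D k l) \<le> G_sum r \<sigma> \<tau>"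
proof -
  have partial: "(\<Sum>k=1..p. \<Sum>l=1..s. \<tau> l * D k l) \<le> (\<Sum>k=1..p. \<tau> k)" if "p \<le> r" for p
  proof -
    have "(\<Sum>k=1..p. D k l) \<le> (\<Sum>k=1..r. D k l)" if "l \<in> {1..s}" for l
      using that D \<open>p \<le> r\<close> by (intro sum_mono2) auto
    then have "0 \<le> (\<Sum>k=1..p. D k l) \<and> (\<Sum>k=1..p. D k l) \<le> 1" if "l \<in> {1..s}" for l
      using that D cols[of l] \<open>p \<le> r\<close> by (fastforce intro!: sum_nonneg)
    moreover have "(\<Sum>l=1..s. \<Sum>k=1..p. D k l) \<le> real p"
    proof -
      have "(\<Sum>l=1..s. \<Sum>k=1..p. D k l) = (\<Sum>k=1..p. \<Sum>l=1..s. D k l)" by (rule sum.swap)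
      also have "\<dots> \<le> (\<Sum>k=1..p. 1)" using rows \<open>p \<le> r\<close> by (intro sum_mono) auto
      finally show ?thesis by simp
    qed
    ultimately have "(\<Sum>l=1..s. \<tau> l * (\<Sum>k=1..p. D k l)) \<le> (\<Sum>k=1..p. \<tau> k)"
      using \<open>p \<le> r\<close> \<open>r \<le> s\<close> by (intro fractional_selection_le_top_sum[OF \<tau>]) auto
    also have "(\<Sum>l=1..s. \<tau> l * (\<Sum>k=1..p. D k l)) = (\<Sum>k=1..p. \<Sum>l=1..s. \<tau> l * D k l)"
      unfolding sum_distrib_left by (rule sum.swap)
    finally show ?thesis .
  qed
  have "0 \<le> (\<Sum>k=1..r. \<sigma> k * (\<tau> k - (\<Sum>l=1..s. \<tau> l * D k l)))"
    using partial by (intro abel_sum_nonneg[OF \<sigma>]) (simp add: sum_subtractf)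
  then show ?thesis
    by (simp add: G_sum_def sum_subtractf sum_distrib_left algebra_simps)
qed

section \<open>Orthonormal families of coordinate functions\<close>

text \<open>Vectors are functions of which only the values below \<open>n\<close> count, so that systems of singular vectors
  are families indexed like the singular values, free of carrier conditions.\<close>

definition cinner :: "nat \<Rightarrow> (nat \<Rightarrow> complex) \<Rightarrow> (nat \<Rightarrow> complex) \<Rightarrow> complex" where
  "cinner n x y = (\<Sum>i<n. x i * cnj (y i))"

definition orthonormal_family :: "nat \<Rightarrow> nat set \<Rightarrow> (nat \<Rightarrow> nat \<Rightarrow> complex) \<Rightarrow> bool" where
  "orthonormal_family n K u \<longleftrightarrow>
     (\<forall>k\<in>K. \<forall>l\<in>K. cinner n (u k) (u l) = (if k = l then 1 else 0))"

lemma cinner_commute: "cinner n y x = cnj (cinner n x y)"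
  by (simp add: cinner_def mult.commute)

text \<open>The projection \<open>p\<close> of \<open>x\<close> onto the span has squared norm equal to the left-hand side, and
  \<open>x - p\<close> has nonnegative squared norm.\<close>

lemma bessel_inequality:
  assumes "finite K" and u: "orthonormal_family n K u"
  shows "(\<Sum>k\<in>K. (cmod (cinner n x (u k)))\<^sup>2) \<le> Re (cinner n x x)"
proof -
  define c where "c k = cinner n x (u k)" for k
  \<comment> \<open>the orthogonal projection of \<open>x\<close>\<close>
  define p where "p i = (\<Sum>k\<in>K. c k * u k i)" for i
  have p_inner: "cinner n p y = (\<Sum>k\<in>K. c k * cinner n (u k) y)" for y
    unfolding cinner_def p_def sum_distrib_left sum_distrib_right
    by (subst sum.swap) (simp add: mult.assoc)
  have "cinner n p (u l) = c l" if "l \<in> K" for l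
  proof -
    have "cinner n p (u l) = (\<Sum>k\<in>K. if k = l then c k else 0)"
      unfolding p_inner using u that by (intro sum.cong) (auto simp: orthonormal_family_def)
    then show ?thesis using that \<open>finite K\<close> by simp
  qed
  then have lp: "cinner n (u l) p = cnj (c l)" if "l \<in> K" for l
    using that cinner_commute[of n "u l" p] by simp
  have xp: "cinner n p x = (\<Sum>k\<in>K. c k * cnj (c k))"
    unfolding p_inner c_def by (simp add: cinner_commute[of n "u _" x])
  have pp: "cinner n p p = (\<Sum>k\<in>K. c k * cnj (c k))"
    unfolding p_inner[of p] using lp by simp
  have "0 \<le> Re (\<Sum>i<n. (x i - p i) * cnj (x i - p i))"
    unfolding Re_sum by (intro sum_nonneg) (simp only: complex_mult_cnj Re_complex_of_real, simp)
  also have "(\<Sum>i<n. (x i - p i) * cnj (x i - p i)) =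
      cinner n x x - cinner n x p - cinner n p x + cinner n p p"
    by (simp add: cinner_def algebra_simps sum.distrib sum_subtractf)
  also have "cinner n x p = cnj (cinner n p x)" by (rule cinner_commute)
  finally have "Re (cinner n p x) \<le> Re (cinner n x x)" by (simp add: pp xp)
  moreover have "Re (cinner n p x) = (\<Sum>k\<in>K. (cmod (c k))\<^sup>2)"
    unfolding xp by (simp add: complex_mult_cnj cmod_def)
  ultimately show ?thesis by (simp add: c_def)
qed

text \<open>The estimate behind von Neumann's inequality. The mean \<open>D\<close> of the squared overlaps dominates their
  product, and by Bessel's inequality its row and column sums are at most 1.\<close>

lemma sum_product_overlaps_bound:
  assumes \<sigma>: "decreasing_positive r \<sigma>" and \<tau>: "decreasing_positive s \<tau>" and "r \<le> s"
    and u: "orthonormal_family m {1..r} u" and v: "orthonormal_family n {1..r} v"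
    and x: "orthonormal_family m {1..s} x" and y: "orthonormal_family n {1..s} y"
  shows "cmod (\<Sum>k=1..r. \<Sum>l=1..s. complex_of_real (\<sigma> k * \<tau> l) *
           (cinner m (u k) (x l) * cinner n (y l) (v k))) \<le> G_sum r \<sigma> \<tau>"
proof -
  define D where "D k l = ((cmod (cinner m (u k) (x l)))\<^sup>2 + (cmod (cinner n (y l) (v k)))\<^sup>2) / 2"
    for k l
  have sym: "cmod (cinner d f g) = cmod (cinner d g f)" for d f g
    by (metis cinner_commute complex_mod_cnj)
  have unit: "Re (cinner d (w k) (w k)) = 1" if "orthonormal_family d K w" "k \<in> K" for d w K k
    using that by (simp add: orthonormal_family_def)
  have pos: "0 \<le> \<sigma> k * \<tau> l" if "k \<in> {1..r}" "l \<in> {1..s}" for k l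
    using that \<sigma> \<tau> by (auto simp: decreasing_positive_def intro!: mult_nonneg_nonneg less_imp_le)
  have "cmod (\<Sum>k=1..r. \<Sum>l=1..s. complex_of_real (\<sigma> k * \<tau> l) *
           (cinner m (u k) (x l) * cinner n (y l) (v k)))
      \<le> (\<Sum>k=1..r. \<Sum>l=1..s. cmod (complex_of_real (\<sigma> k * \<tau> l) *
           (cinner m (u k) (x l) * cinner n (y l) (v k))))"
    by (intro order_trans[OF norm_sum] sum_mono order_refl)
  also have "\<dots> \<le> (\<Sum>k=1..r. \<Sum>l=1..s. \<sigma> k * \<tau> l * D k l)"
  proof (intro sum_mono)
    fix k l assume kl: "k \<in> {1..r}" "l \<in> {1..s}"
    have "cmod (cinner m (u k) (x l)) * cmod (cinner n (y l) (v k)) \<le> D k l"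
      unfolding D_def
      using sum_squares_bound[of "cmod (cinner m (u k) (x l))" "cmod (cinner n (y l) (v k))"]
      by simp
    from mult_left_mono[OF this pos[OF kl]] pos[OF kl]
    show "cmod (complex_of_real (\<sigma> k * \<tau> l) * (cinner m (u k) (x l) * cinner n (y l) (v k)))
        \<le> \<sigma> k * \<tau> l * D k l"
      by (simp add: norm_mult abs_mult[symmetric] del: of_real_mult)
  qed
  also have "\<dots> \<le> G_sum r \<sigma> \<tau>"
  proof (rule doubly_substochastic_bound[OF \<sigma> \<tau> \<open>r \<le> s\<close>])
    show "0 \<le> D k l" for k l by (simp add: D_def)
  next
    fix k assume k: "k \<in> {1..r}"
    have "(\<Sum>l=1..s. (cmod (cinner m (u k) (x l)))\<^sup>2) \<le> 1"
      using bessel_inequality[OF _ x, of "u k"] unit[OF u k] by simp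
    moreover have "(\<Sum>l=1..s. (cmod (cinner n (y l) (v k)))\<^sup>2) \<le> 1"
      using bessel_inequality[OF _ y, of "v k"] unit[OF v k] by (simp add: sym[of n "v k"])
    ultimately show "(\<Sum>l=1..s. D k l) \<le> 1"
      by (simp add: D_def sum.distrib sum_divide_distrib[symmetric])
  next
    fix l assume l: "l \<in> {1..s}"
    have "(\<Sum>k=1..r. (cmod (cinner m (u k) (x l)))\<^sup>2) \<le> 1"
      using bessel_inequality[OF _ u, of "x l"] unit[OF x l] by (simp add: sym[of m "x l"])
    moreover have "(\<Sum>k=1..r. (cmod (cinner n (y l) (v k)))\<^sup>2) \<le> 1"
      using bessel_inequality[OF _ v, of "y l"] unit[OF y l] by simp
    ultimately show "(\<Sum>k=1..r. D k l) \<le> 1"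
      by (simp add: D_def sum.distrib sum_divide_distrib[symmetric])
  qed
  finally show ?thesis .
qed


section \<open>Adjoints and Gram matrices\<close>

lemma mat_adjoint_dim [simp]:
  "dim_row (mat_adjoint A) = dim_col A" "dim_col (mat_adjoint A) = dim_row A"
  by (auto simp: mat_adjoint_def)

lemma mat_adjoint_carrier [simp]: "A \<in> carrier_mat m n \<Longrightarrow> mat_adjoint A \<in> carrier_mat n m"
  by (auto simp: mat_adjoint_def)

lemma mat_adjoint_index [simp]:
  fixes A :: "complex mat"
  shows "i < dim_col A \<Longrightarrow> j < dim_row A \<Longrightarrow> mat_adjoint A $$ (i, j) = cnj (A $$ (j, i))"
  by (simp add: mat_adjoint_def mat_of_rows_index)

lemma mat_adjoint_mult:
  fixes A B :: "complex mat"
  assumes "A \<in> carrier_mat m n" "B \<in> carrier_mat n p"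
  shows "mat_adjoint (A * B) = mat_adjoint B * mat_adjoint A"
  using assms by (intro eq_matI) (auto simp: scalar_prod_def mult.commute intro!: sum.cong)

lemma mat_adjoint_adjoint [simp]: "mat_adjoint (mat_adjoint A) = (A :: complex mat)"
  by (intro eq_matI) auto

lemma gram_matrix_mult:
  fixes A U :: "complex mat"
  assumes A: "A \<in> carrier_mat m n" and U: "U \<in> carrier_mat n p"
  shows "mat_adjoint U * (mat_adjoint A * A) * U = mat_adjoint (A * U) * (A * U)"
proof -
  have adj: "mat_adjoint A \<in> carrier_mat n m" "mat_adjoint U \<in> carrier_mat p n"
    using A U by auto
  have "mat_adjoint U * (mat_adjoint A * A) = mat_adjoint (A * U) * A"
    unfolding mat_adjoint_mult[OF A U] by (rule assoc_mult_mat[OF adj(2,1) A, symmetric])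
  then show ?thesis
    using assoc_mult_mat[of "mat_adjoint (A * U)" p m A n U p] A U by simp
qed

lemma gram_matrix_index:
  fixes A :: "complex mat"
  assumes "A \<in> carrier_mat m n" "i < n" "j < n"
  shows "(mat_adjoint A * A) $$ (i, j) = (\<Sum>k<m. cnj (A $$ (k, i)) * A $$ (k, j))"
  using assms by (simp add: scalar_prod_def atLeast0LessThan)

text \<open>Polarization: the quadratic forms at \<open>e\<^sub>i + c e\<^sub>j\<close> for \<open>c \<in> {0, \<plusminus>1, \<plusminus>\<i>}\<close> determine the entry \<open>(i, j)\<close>
  of the Gram matrix.\<close>

lemma gram_matrix_eqI:
  fixes A H :: "complex mat"
  assumes A: "A \<in> carrier_mat m n" and H: "H \<in> carrier_mat p n"
    and iso: "\<And>x. x \<in> carrier_vec n \<Longrightarrow> (A *\<^sub>v x) \<bullet>c (A *\<^sub>v x) = (H *\<^sub>v x) \<bullet>c (H *\<^sub>v x)"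
  shows "mat_adjoint A * A = mat_adjoint H * H"
proof (rule eq_matI)
  fix i j assume "i < dim_row (mat_adjoint H * H)" "j < dim_col (mat_adjoint H * H)"
  then have ij: "i < n" "j < n" using H by auto
  define g where "g B i j = col B j \<bullet>c col B i" for B :: "complex mat" and i j
  have expand: "(B *\<^sub>v (unit_vec n i + c \<cdot>\<^sub>v unit_vec n j)) \<bullet>c (B *\<^sub>v (unit_vec n i + c \<cdot>\<^sub>v unit_vec n j))
      = g B i i + cnj c * g B j i + c * g B i j + c * cnj c * g B j j"
    if B: "B \<in> carrier_mat q n" for B q c
  proof -
    have "B *\<^sub>v (unit_vec n i + c \<cdot>\<^sub>v unit_vec n j) = col B i + c \<cdot>\<^sub>v col B j"
      using B ij by (intro eq_vecI) (auto simp: scalar_prod_add_distrib[of _ n])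
    then show ?thesis
      using B unfolding g_def
      by (simp add: scalar_prod_def sum.distrib sum_distrib_left algebra_simps)
  qed
  have eq: "g A i i + cnj c * g A j i + c * g A i j + c * cnj c * g A j j
      = g H i i + cnj c * g H j i + c * g H i j + c * cnj c * g H j j" for c
    using iso[of "unit_vec n i + c \<cdot>\<^sub>v unit_vec n j"] expand[OF A, of c] expand[OF H, of c]
    by simp
  have "g A i j = g H i j"
    using eq[of 0] eq[of 1] eq[of "-1"] eq[of \<i>] eq[of "-\<i>"]
    by (simp add: complex_eq_iff)
  then show "(mat_adjoint A * A) $$ (i, j) = (mat_adjoint H * H) $$ (i, j)"
    using A H ij by (simp add: g_def scalar_prod_def mult.commute)
qed (use A H in auto)

section \<open>Spectral decomposition of Hermitian matrices\<close>

text \<open>Gram--Schmidt applied to a basis that starts with \<open>v\<close> keeps \<open>v\<close> in first place; its output is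
  orthogonal but not normalized, which is why only a multiple of \<open>v\<close> is the first column.\<close>

lemma unitary_with_first_column:
  fixes v :: "complex vec"
  assumes v: "v \<in> carrier_vec n" and v0: "v \<noteq> 0\<^sub>v n"
  obtains W c where "W \<in> carrier_mat n n" "mat_adjoint W * W = 1\<^sub>m n" "col W 0 = c \<cdot>\<^sub>v v"
proof -
  interpret cof_vec_space n "TYPE(complex)" .
  define b where "b = basis_completion v"
  define ws where "ws = gram_schmidt n b"
  from basis_completion[OF v v0, folded b_def]
  have dist_b: "distinct b" and indep: "\<not> lin_dep (set b)" and b: "set b \<subseteq> carrier_vec n"
    and hdb: "hd b = v" and len_b: "length b = n" by auto
  have n: "n \<noteq> 0" using v v0 by auto
  from hdb len_b n obtain vs where bv: "b = v # vs" by (cases b) auto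
  from gram_schmidt_result[OF b dist_b indep refl, folded ws_def]
  have ws: "set ws \<subseteq> carrier_vec n" "corthogonal ws" "length ws = n" by (auto simp: len_b)
  from gram_schmidt_hd[OF v, of vs, folded bv] have hdws: "hd ws = v" unfolding ws_def .
  have wsj: "ws ! j \<in> carrier_vec n" if "j < n" for j using ws that by auto
  \<comment> \<open>the Euclidean norm of the \<open>j\<close>-th vector\<close>
  define N where "N j = complex_of_real (sqrt (Re (ws ! j \<bullet>c ws ! j)))" for j
  have N: "N j * N j = ws ! j \<bullet>c ws ! j" "cnj (N j) = N j" "N j \<noteq> 0" if "j < n" for j
  proof -
    have "0 \<le> ws ! j \<bullet>c ws ! j" by (rule conjugate_square_ge_0_vec)
    moreover have "ws ! j \<bullet>c ws ! j \<noteq> 0"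
      using corthogonalD[OF ws(2), of j j] that ws(3) by auto
    ultimately show "N j * N j = ws ! j \<bullet>c ws ! j" "cnj (N j) = N j" "N j \<noteq> 0"
      by (auto simp: N_def less_eq_complex_def complex_eq_iff simp flip: of_real_mult)
  qed
  define W where "W = mat n n (\<lambda>(i, j). ws ! j $ i / N j)"
  have ws0: "ws ! 0 = v" using hdws ws(3) n by (cases ws) auto
  have "mat_adjoint W * W = 1\<^sub>m n"
  proof (rule eq_matI)
    fix i j assume "i < dim_row (1\<^sub>m n)" "j < dim_col (1\<^sub>m n)"
    then have ij: "i < n" "j < n" by auto
    have "(mat_adjoint W * W) $$ (i, j) = (ws ! j \<bullet>c ws ! i) / (N i * N j)"
      using ij wsj[OF ij(1)] wsj[OF ij(2)] N(2)[OF ij(1)]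
      by (subst gram_matrix_index[of W n n])
        (auto simp: W_def scalar_prod_def atLeast0LessThan sum_divide_distrib algebra_simps)
    also have "\<dots> = 1\<^sub>m n $$ (i, j)"
      using corthogonalD[OF ws(2), of j i] ij ws(3) N[OF ij(1)] by auto
    finally show "(mat_adjoint W * W) $$ (i, j) = 1\<^sub>m n $$ (i, j)" .
  qed (auto simp: W_def)
  moreover have "col W 0 = (1 / N 0) \<cdot>\<^sub>v v"
    using n ws0 v by (intro eq_vecI) (auto simp: W_def)
  ultimately show ?thesis using that[of W] by (auto simp: W_def)
qed

text \<open>Deflation by an eigenvector of the first listed eigenvalue. In a unitary basis starting with that
  vector the first column of the matrix is \<open>e\<close> times a unit vector, and by Hermitian symmetry so is the
  first row; the complementary block is Hermitian with the remaining eigenvalues. The list \<open>es\<close> may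
  order the eigenvalues in any way, so that the nonzero ones can later be placed first.\<close>

lemma hermitian_spectral_decomposition:
  fixes A :: "complex mat"
  assumes "A \<in> carrier_mat n n" and "mat_adjoint A = A"
    and "char_poly A = (\<Prod>e\<leftarrow>es. [:- e, 1:])"
  shows "\<exists>U \<in> carrier_mat n n. mat_adjoint U * U = 1\<^sub>m n \<and> mat_adjoint U * A * U = mat_diag n ((!) es)"
  using assms
proof (induction es arbitrary: n A)
  case Nil
  with degree_monic_char_poly[of A n] have "n = 0" by auto
  with Nil(1) show ?case by (intro bexI[of _ "1\<^sub>m 0"] conjI eq_matI) (auto simp: mat_diag_def)
next
  case (Cons e es n A)
  note A = Cons.prems(1) and herm = Cons.prems(2)
  have cp: "char_poly A = [:- e, 1:] * (\<Prod>e\<leftarrow>es. [:- e, 1:])" using Cons.prems(3) by simp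
  have "eigenvalue A e" unfolding eigenvalue_root_char_poly[OF A] cp by simp
  then obtain v where v: "v \<in> carrier_vec n" "v \<noteq> 0\<^sub>v n" and eig: "A *\<^sub>v v = e \<cdot>\<^sub>v v"
    using A unfolding eigenvalue_def eigenvector_def by auto
  obtain k where n: "n = Suc k" using v by (cases n) auto
  obtain W c where W: "W \<in> carrier_mat n n" and WW: "mat_adjoint W * W = 1\<^sub>m n"
    and W0: "col W 0 = c \<cdot>\<^sub>v v"
    using unitary_with_first_column[OF v] by blast
  have W': "mat_adjoint W \<in> carrier_mat n n" using W by simp
  have WW': "W * mat_adjoint W = 1\<^sub>m n" using mat_mult_left_right_inverse[OF W' W WW] .
  define A' where "A' = mat_adjoint W * A * W"
  have A': "A' \<in> carrier_mat n n" unfolding A'_def by (rule mult_carrier_mat[OF mult_carrier_mat[OF W' A] W])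
  have herm': "mat_adjoint A' = A'"
    unfolding A'_def using A W W' herm
    by (simp add: mat_adjoint_mult[of _ n n _ n] assoc_mult_mat[of _ n n _ n _ n])
  have col0: "A' $$ (i, 0) = (if i = 0 then e else 0)" if "i < n" for i
  proof -
    have "A *\<^sub>v col W 0 = e \<cdot>\<^sub>v col W 0"
      unfolding W0 using A v eig by (simp add: mult_mat_vec smult_smult_assoc mult.commute)
    have colW: "col W 0 \<in> carrier_vec n" using W by (simp add: carrier_vecI)
    have "col A' 0 = (mat_adjoint W * A) *\<^sub>v col W 0"
      unfolding A'_def by (rule col_mult2[OF mult_carrier_mat[OF W' A] W]) (simp add: n)
    also have "\<dots> = mat_adjoint W *\<^sub>v (A *\<^sub>v col W 0)"
      by (rule assoc_mult_mat_vec[OF W' A colW])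
    also have "\<dots> = e \<cdot>\<^sub>v (mat_adjoint W *\<^sub>v col W 0)"
      unfolding \<open>A *\<^sub>v col W 0 = e \<cdot>\<^sub>v col W 0\<close>
      by (rule mult_mat_vec[OF W' colW])
    also have "mat_adjoint W *\<^sub>v col W 0 = col (mat_adjoint W * W) 0"
      by (rule col_mult2[OF W' W, symmetric]) (simp add: n)
    finally have "col A' 0 = e \<cdot>\<^sub>v col (1\<^sub>m n) 0" unfolding WW .
    then have "col A' 0 $ i = (e \<cdot>\<^sub>v col (1\<^sub>m n) 0) $ i" by simp
    then show ?thesis using that A' n by (simp split: if_splits)
  qed
  have row0: "A' $$ (0, j) = (if j = 0 then e else 0)" if "j < n" for j
  proof -
    have "A' $$ (0, j) = cnj (A' $$ (j, 0))"
      using mat_adjoint_index[of 0 A' j] that A' n unfolding herm' by auto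
    moreover have "A' $$ (0, 0) = cnj (A' $$ (0, 0))"
      using mat_adjoint_index[of 0 A' 0] A' n unfolding herm' by auto
    ultimately show ?thesis using col0[of j] col0[of 0] that n by auto
  qed
  \<comment> \<open>the block of \<open>A'\<close> left after splitting off the eigenvector\<close>
  define B where "B = mat k k (\<lambda>(i, j). A' $$ (Suc i, Suc j))"
  define E where "E = mat 1 1 (\<lambda>_. e)"
  have B: "B \<in> carrier_mat k k" and E: "E \<in> carrier_mat 1 1" by (auto simp: B_def E_def)
  have block: "A' = four_block_mat E (0\<^sub>m 1 k) (0\<^sub>m k 1) B"
  proof (rule eq_matI)
    fix i j
    assume "i < dim_row (four_block_mat E (0\<^sub>m 1 k) (0\<^sub>m k 1) B)"
      "j < dim_col (four_block_mat E (0\<^sub>m 1 k) (0\<^sub>m k 1) B)"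
    then have "i < n" "j < n" using B E n by auto
    then show "A' $$ (i, j) = four_block_mat E (0\<^sub>m 1 k) (0\<^sub>m k 1) B $$ (i, j)"
      using B E n col0 row0 by (cases i; cases j) (auto simp: B_def E_def)
  qed (use A' B E n in auto)
  have "mat_adjoint B = B"
  proof (rule eq_matI)
    fix i j assume ij: "i < dim_row B" "j < dim_col B"
    then have "A' $$ (Suc i, Suc j) = cnj (A' $$ (Suc j, Suc i))"
      using mat_adjoint_index[of "Suc i" A' "Suc j"] A' n B unfolding herm' by auto
    then show "mat_adjoint B $$ (i, j) = B $$ (i, j)" using ij B by (simp add: B_def)
  qed (use B in auto)
  moreover have "char_poly B = (\<Prod>e\<leftarrow>es. [:- e, 1:])"
  proof -
    have "similar_mat A' A"
      by (rule similar_matI[of _ _ "mat_adjoint W" W n]) (use A' A W W' WW WW' in \<open>auto simp: A'_def\<close>)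
    then have "char_poly E * char_poly B = [:- e, 1:] * (\<Prod>e\<leftarrow>es. [:- e, 1:])"
      using char_poly_similar[of A' A] cp
        char_poly_four_block_zeros_col[OF E zero_carrier_mat B] unfolding block by metis
    moreover have "char_poly E = [:- e, 1:]"
      by (simp add: E_def char_poly_defs det_def sign_def)
    ultimately show ?thesis by (metis mult_cancel_left pCons_eq_0_iff zero_neq_one)
  qed
  ultimately obtain V where V: "V \<in> carrier_mat k k" and VV: "mat_adjoint V * V = 1\<^sub>m k"
    and VBV: "mat_adjoint V * B * V = mat_diag k ((!) es)"
    using Cons.IH[OF B] by blast
  define P where "P = four_block_mat (1\<^sub>m 1) (0\<^sub>m 1 k) (0\<^sub>m k 1) V"
  have P: "P \<in> carrier_mat n n" using V n by (auto simp: P_def)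
  have P_adj: "mat_adjoint P = four_block_mat (1\<^sub>m 1) (0\<^sub>m 1 k) (0\<^sub>m k 1) (mat_adjoint V)"
    using V by (intro eq_matI) (auto simp: P_def)
  have V': "mat_adjoint V \<in> carrier_mat k k" using V by simp
  have PP: "mat_adjoint P * P = 1\<^sub>m n"
  proof -
    have "mat_adjoint P * P = four_block_mat (1\<^sub>m 1) (0\<^sub>m 1 k) (0\<^sub>m k 1) (mat_adjoint V * V)"
      unfolding P_adj unfolding P_def using V V'
      by (subst mult_four_block_mat[of _ 1 1 _ k _ k _ _ 1 _ k]) auto
    then show ?thesis unfolding VV using n by (simp add: four_block_one_mat)
  qed
  have PAP: "mat_adjoint P * A' * P = mat_diag n ((!) (e # es))"
  proof -
    have "mat_adjoint P * A' = four_block_mat E (0\<^sub>m 1 k) (0\<^sub>m k 1) (mat_adjoint V * B)"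
      unfolding P_adj block using V' B E right_mult_zero_mat[OF V', of 1]
      by (subst mult_four_block_mat[of _ 1 1 _ k _ k _ _ 1 _ k]) auto
    then have "mat_adjoint P * A' * P =
        four_block_mat E (0\<^sub>m 1 k) (0\<^sub>m k 1) (mat_adjoint V * B * V)"
      unfolding P_def using V V' B E
      by (simp, subst mult_four_block_mat[of _ 1 1 _ k _ k _ _ 1 _ k]) auto
    then show ?thesis unfolding VBV using n E
      by (intro eq_matI) (auto simp: E_def mat_diag_def nth_Cons')
  qed
  show ?case
  proof (intro bexI conjI)
    show "W * P \<in> carrier_mat n n" using W P by simp
    have adj: "mat_adjoint (W * P) = mat_adjoint P * mat_adjoint W"
      by (rule mat_adjoint_mult[OF W P])
    have P': "mat_adjoint P \<in> carrier_mat n n" using P by simp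
    have "mat_adjoint (W * P) * (W * P) = mat_adjoint P * ((mat_adjoint W * W) * P)"
      unfolding adj using P P' W W' by (simp add: assoc_mult_mat[of _ n n _ n _ n])
    then show "mat_adjoint (W * P) * (W * P) = 1\<^sub>m n" using WW PP P by simp
    have "mat_adjoint (W * P) * A * (W * P) = mat_adjoint P * A' * P"
    proof -
      have W'A: "mat_adjoint W * A \<in> carrier_mat n n" by (rule mult_carrier_mat[OF W' A])
      have P'W'A: "mat_adjoint P * (mat_adjoint W * A) \<in> carrier_mat n n"
        by (rule mult_carrier_mat[OF P' W'A])
      show ?thesis
        unfolding adj A'_def assoc_mult_mat[OF P' W' A]
          assoc_mult_mat[OF P'W'A W P, symmetric] assoc_mult_mat[OF P' W'A W] ..
    qed
    then show "mat_adjoint (W * P) * A * (W * P) = mat_diag n ((!) (e # es))" using PAP by simp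
  qed
qed


section \<open>Singular value decomposition\<close>

lemma proots_linear_factors:
  fixes bs :: "'a::idom list"
  shows "proots (\<Prod>a\<leftarrow>bs. [:- a, 1:]) = mset bs"
proof (induction bs)
  case (Cons b bs)
  have "(\<Prod>a\<leftarrow>bs. [:- a, 1:]) \<noteq> 0" by (auto simp: prod_list_zero_iff)
  with Cons show ?case by (simp add: proots_mult del: mult_pCons_left)
qed simp

text \<open>After diagonalization by \<open>U\<close> the eigenvalues are the squared column norms of \<open>A U\<close>.\<close>

lemma gram_matrix_eigenvalues_nonneg:
  fixes A :: "complex mat"
  assumes A: "A \<in> carrier_mat m n"
    and cp: "char_poly (mat_adjoint A * A) = (\<Prod>e\<leftarrow>es. [:- e, 1:])" and "e \<in> set es"
  shows "e = complex_of_real ((sqrt (Re e))\<^sup>2)"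
proof -
  let ?G = "mat_adjoint A * A"
  have A': "mat_adjoint A \<in> carrier_mat n m" using A by simp
  have G: "?G \<in> carrier_mat n n" by (rule mult_carrier_mat[OF A' A])
  have herm: "mat_adjoint ?G = ?G" using mat_adjoint_mult[OF A' A] by simp
  have "length es = n"
    using degree_monic_char_poly[OF G] cp degree_linear_factors[of uminus es] by simp
  then obtain k where k: "k < n" "e = es ! k" using \<open>e \<in> set es\<close> by (auto simp: in_set_conv_nth)
  obtain U where U: "U \<in> carrier_mat n n" and diag: "mat_adjoint U * ?G * U = mat_diag n ((!) es)"
    using hermitian_spectral_decomposition[OF G herm cp] by blast
  have "mat_adjoint U * ?G * U = mat_adjoint (A * U) * (A * U)"
    by (rule gram_matrix_mult[OF A U])
  then have "mat_adjoint (A * U) * (A * U) = mat_diag n ((!) es)" using diag by simp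
  then have "e = (mat_adjoint (A * U) * (A * U)) $$ (k, k)"
    using k by (simp add: mat_diag_def)
  also have "\<dots> = (\<Sum>i<m. cnj ((A * U) $$ (i, k)) * (A * U) $$ (i, k))"
    using A U k by (intro gram_matrix_index[of _ m n]) auto
  also have "\<dots> = complex_of_real (\<Sum>i<m. (cmod ((A * U) $$ (i, k)))\<^sup>2)"
    by (simp add: complex_norm_square mult.commute del: of_real_power)
  finally have "e = complex_of_real (\<Sum>i<m. (cmod ((A * U) $$ (i, k)))\<^sup>2)" .
  then show ?thesis
    by (simp only: Re_complex_of_real) (simp add: sum_nonneg del: of_real_power of_real_sum)
qed

text \<open>Recovers the whole spectrum of \<open>A\<^sup>*A\<close> from the nonzero singular values. The map \<open>z \<mapsto> sqrt (Re z)\<close>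
  from eigenvalues to singular values is inverted by squaring, as the eigenvalues are real and
  nonnegative; the remaining \<open>n - r\<close> eigenvalues vanish.\<close>

lemma char_poly_gram_matrix_eq:
  fixes A :: "complex mat"
  assumes A: "A \<in> carrier_mat m n" and sv: "has_nonzero_singular_values A r \<sigma>"
  shows "r \<le> n"
    and "char_poly (mat_adjoint A * A) =
      (\<Prod>e\<leftarrow>map (\<lambda>k. complex_of_real ((\<sigma> k)\<^sup>2)) [1..<Suc r] @ replicate (n - r) 0. [:- e, 1:])"
proof -
  let ?G = "mat_adjoint A * A"
  let ?es = "map (\<lambda>k. complex_of_real ((\<sigma> k)\<^sup>2)) [1..<Suc r] @ replicate (n - r) 0"
  have G: "?G \<in> carrier_mat n n" using A by (intro mult_carrier_mat[of _ n m]) auto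
  obtain as where cp: "char_poly ?G = (\<Prod>a\<leftarrow>as. [:- a, 1:])" and len: "length as = n"
    using char_poly_factorized[OF G] by blast
  have "proots (char_poly ?G) = mset as" unfolding cp by (rule proots_linear_factors)
  then have sv: "image_mset (\<lambda>z. sqrt (Re z)) (filter_mset (\<lambda>z. z \<noteq> 0) (mset as)) =
      image_mset \<sigma> (mset_set {1..r})"
    using sv by (simp add: has_nonzero_singular_values_def nonzero_singular_values_def)
  have "filter_mset (\<lambda>z. z \<noteq> 0) (mset as) = image_mset (\<lambda>z. complex_of_real ((sqrt (Re z))\<^sup>2))
      (filter_mset (\<lambda>z. z \<noteq> 0) (mset as))"
    using gram_matrix_eigenvalues_nonneg[OF A cp]
    by (intro multiset.map_ident_strong[symmetric]) (auto simp del: of_real_power)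
  also have "\<dots> = image_mset (\<lambda>x. complex_of_real (x\<^sup>2)) (image_mset \<sigma> (mset_set {1..r}))"
    unfolding sv[symmetric] by (simp add: multiset.map_comp o_def)
  also have "\<dots> = mset (map (\<lambda>k. complex_of_real ((\<sigma> k)\<^sup>2)) [1..<Suc r])"
    by (simp add: multiset.map_comp o_def atLeastLessThanSuc_atLeastAtMost del: upt_Suc)
  finally have nonzero: "filter_mset (\<lambda>z. z \<noteq> 0) (mset as) =
      mset (map (\<lambda>k. complex_of_real ((\<sigma> k)\<^sup>2)) [1..<Suc r])" .
  have parts: "mset as = filter_mset (\<lambda>z. z \<noteq> 0) (mset as) + filter_mset (\<lambda>z. z = 0) (mset as)"
    by (subst multiset_partition[of _ "\<lambda>z. z \<noteq> 0"]) simp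
  have zero: "filter_mset (\<lambda>z. z = 0) (mset as) = replicate_mset (count (mset as) 0) 0"
    by (simp add: filter_eq_replicate_mset)
  have "n = r + count (mset as) 0"
    using arg_cong[OF parts, of size] len unfolding nonzero zero by simp
  then show "r \<le> n" by simp
  have "mset as = mset ?es"
    using \<open>n = r + count (mset as) 0\<close> by (subst parts, unfold nonzero zero) simp
  then have "prod_mset (image_mset (\<lambda>e. [:- e, 1:]) (mset as)) =
      prod_mset (image_mset (\<lambda>e. [:- e, 1:]) (mset ?es))" by (rule arg_cong)
  then show "char_poly ?G = (\<Prod>e\<leftarrow>?es. [:- e, 1:])"
    unfolding cp mset_map[symmetric] prod_mset_prod_list .
qed

text \<open>If \<open>V\<close> diagonalizes \<open>A\<^sup>*A\<close>, the columns of \<open>M = A V\<close> are orthogonal with squared norms the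
  eigenvalues. So only the first \<open>r\<close> of them are nonzero; these become the \<open>u\<^sub>k\<close> after division by
  \<open>\<sigma>\<^sub>k\<close>, and \<open>A = M V\<^sup>*\<close> is the asserted expansion.\<close>

lemma singular_value_decomposition:
  fixes A :: "complex mat"
  assumes A: "A \<in> carrier_mat m n" and sv: "has_nonzero_singular_values A r \<sigma>"
    and pos: "\<And>k. k \<in> {1..r} \<Longrightarrow> 0 < \<sigma> k"
  obtains u v where "orthonormal_family m {1..r} u" "orthonormal_family n {1..r} v"
    "\<And>i j. i < m \<Longrightarrow> j < n \<Longrightarrow>
      A $$ (i, j) = (\<Sum>k=1..r. complex_of_real (\<sigma> k) * u k i * cnj (v k j))"
proof -
  let ?G = "mat_adjoint A * A"
  define es where "es = map (\<lambda>k. complex_of_real ((\<sigma> k)\<^sup>2)) [1..<Suc r] @ replicate (n - r) 0"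
  note rn = char_poly_gram_matrix_eq(1)[OF A sv]
  have es_nth: "es ! q = (if q < r then complex_of_real ((\<sigma> (Suc q))\<^sup>2) else 0)" if "q < n" for q
    using that unfolding es_def by (auto simp: nth_append simp del: upt_Suc)
  have A': "mat_adjoint A \<in> carrier_mat n m" using A by simp
  have G: "?G \<in> carrier_mat n n" by (rule mult_carrier_mat[OF A' A])
  have herm: "mat_adjoint ?G = ?G" using mat_adjoint_mult[OF A' A] by simp
  obtain V where V: "V \<in> carrier_mat n n" and VV: "mat_adjoint V * V = 1\<^sub>m n"
    and diag: "mat_adjoint V * ?G * V = mat_diag n ((!) es)"
    using hermitian_spectral_decomposition[OF G herm
        char_poly_gram_matrix_eq(2)[OF A sv, folded es_def]] by blast
  have V': "mat_adjoint V \<in> carrier_mat n n" using V by simp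
  have VV': "V * mat_adjoint V = 1\<^sub>m n" using mat_mult_left_right_inverse[OF V' V VV] .
  \<comment> \<open>The columns of \<open>V\<close> are right singular vectors, those of \<open>M\<close> unnormalized left ones.\<close>
  define M where "M = A * V"
  have M: "M \<in> carrier_mat m n" using A V by (simp add: M_def)
  have "mat_adjoint V * ?G * V = mat_adjoint M * M"
    unfolding M_def by (rule gram_matrix_mult[OF A V])
  then have gram: "mat_adjoint M * M = mat_diag n ((!) es)" using diag by simp
  have MM: "(\<Sum>i<m. cnj (M $$ (i, p)) * M $$ (i, q)) = (if p = q then es ! p else 0)"
    if "p < n" "q < n" for p q
    using that gram_matrix_index[OF M, of p q] unfolding gram
    by (cases "p = q") (simp_all add: mat_diag_def)
  have M0: "M $$ (i, q) = 0" if "i < m" "r \<le> q" "q < n" for i q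
  proof -
    have "complex_of_real (\<Sum>i<m. (cmod (M $$ (i, q)))\<^sup>2) = 0"
      using MM[of q q] es_nth[of q] that
      by (simp add: complex_norm_square mult.commute del: of_real_power)
    then have "(\<Sum>i<m. (cmod (M $$ (i, q)))\<^sup>2) = 0" by (simp only: of_real_eq_0_iff)
    then show ?thesis using that by (subst (asm) sum_nonneg_eq_0_iff) auto
  qed
  \<comment> \<open>Singular values are indexed from 1, matrix columns from 0.\<close>
  define u where "u k i = M $$ (i, k - 1) / complex_of_real (\<sigma> k)" for k i
  define v where "v k j = V $$ (j, k - 1)" for k j
  show ?thesis
  proof
    show "orthonormal_family n {1..r} v"
      unfolding orthonormal_family_def
    proof (intro ballI)
      fix k l assume kl: "k \<in> {1..r}" "l \<in> {1..r}"
      then have "k - 1 < n" "l - 1 < n" "k = l \<longleftrightarrow> k - 1 = l - 1" using rn by auto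
      then show "cinner n (v k) (v l) = (if k = l then 1 else 0)"
        using gram_matrix_index[OF V, of "l - 1" "k - 1"] unfolding VV
        by (cases "k = l") (simp_all add: cinner_def v_def mult.commute)
    qed
  next
    show "orthonormal_family m {1..r} u"
      unfolding orthonormal_family_def
    proof (intro ballI)
      fix k l assume kl: "k \<in> {1..r}" "l \<in> {1..r}"
      then have less: "k - 1 < n" "l - 1 < n" "k - 1 < r" and eq: "l - 1 = k - 1 \<longleftrightarrow> k = l"
        and "Suc (k - 1) = k" using rn by auto
      have "cinner m (u k) (u l) = (\<Sum>i<m. cnj (M $$ (i, l - 1)) * M $$ (i, k - 1)) /
          complex_of_real (\<sigma> k * \<sigma> l)"
        by (simp add: cinner_def u_def sum_divide_distrib mult.commute)
      also have "\<dots> = (if k = l then 1 else 0)"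
        using MM[OF less(2) less(1)] es_nth[OF less(1)] less(3) pos[OF kl(1)] \<open>Suc (k - 1) = k\<close> eq
        by (auto simp: power2_eq_square)
      finally show "cinner m (u k) (u l) = (if k = l then 1 else 0)" .
    qed
  next
    fix i j assume ij: "i < m" "j < n"
    have "M * mat_adjoint V = A"
      unfolding M_def using A V V' VV' by (simp add: assoc_mult_mat[of _ m n _ n _ n])
    then have "A $$ (i, j) = (M * mat_adjoint V) $$ (i, j)" by simp
    also have "\<dots> = (\<Sum>q<n. M $$ (i, q) * cnj (V $$ (j, q)))"
      using M V ij by (simp add: scalar_prod_def atLeast0LessThan)
    also have "\<dots> = (\<Sum>q<r. M $$ (i, q) * cnj (V $$ (j, q)))"
      using rn M0 ij by (intro sum.mono_neutral_right) auto
    also have "\<dots> = (\<Sum>k=1..r. M $$ (i, k - 1) * cnj (V $$ (j, k - 1)))"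
      by (rule sum.reindex_bij_witness[of _ "\<lambda>k. k - 1" Suc]) auto
    also have "\<dots> = (\<Sum>k=1..r. complex_of_real (\<sigma> k) * u k i * cnj (v k j))"
      using pos by (intro sum.cong) (force simp: u_def v_def)+
    finally show "A $$ (i, j) = (\<Sum>k=1..r. complex_of_real (\<sigma> k) * u k i * cnj (v k j))" .
  qed
qed

section \<open>Von Neumann's trace inequality\<close>

definition frobenius_inner :: "complex mat \<Rightarrow> complex mat \<Rightarrow> complex" where
  "frobenius_inner A B = (\<Sum>i<dim_row A. \<Sum>j<dim_col A. A $$ (i, j) * cnj (B $$ (i, j)))"

lemma frobenius_norm_square:
  "complex_of_real ((frobenius_norm A)\<^sup>2) = frobenius_inner A A"
  by (simp add: frobenius_norm_def frobenius_inner_def sum_nonneg complex_norm_square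
      del: of_real_power)

lemma frobenius_norm_add_square:
  assumes "A \<in> carrier_mat m n" "B \<in> carrier_mat m n"
  shows "(frobenius_norm (A + B))\<^sup>2 =
    (frobenius_norm A)\<^sup>2 + (frobenius_norm B)\<^sup>2 + 2 * Re (frobenius_inner A B)"
proof -
  have "frobenius_inner (A + B) (A + B) =
      frobenius_inner A A + frobenius_inner B B + (frobenius_inner A B + cnj (frobenius_inner A B))"
    using assms by (simp add: frobenius_inner_def algebra_simps sum.distrib)
  from arg_cong[OF this, of Re] show ?thesis
    by (simp flip: frobenius_norm_square)
qed

lemma frobenius_inner_dyads:
  assumes A: "A \<in> carrier_mat m n"
    and eqA: "\<And>i j. i < m \<Longrightarrow> j < n \<Longrightarrow>
      A $$ (i, j) = (\<Sum>k=1..r. complex_of_real (\<sigma> k) * u k i * cnj (v k j))"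
    and eqB: "\<And>i j. i < m \<Longrightarrow> j < n \<Longrightarrow>
      B $$ (i, j) = (\<Sum>l=1..s. complex_of_real (\<tau> l) * x l i * cnj (y l j))"
  shows "frobenius_inner A B = (\<Sum>k=1..r. \<Sum>l=1..s. complex_of_real (\<sigma> k * \<tau> l) *
      (cinner m (u k) (x l) * cinner n (y l) (v k)))"
proof -
  have "frobenius_inner A B = (\<Sum>i<m. \<Sum>j<n. \<Sum>k=1..r. \<Sum>l=1..s.
      complex_of_real (\<sigma> k * \<tau> l) * ((u k i * cnj (x l i)) * (y l j * cnj (v k j))))"
    using A by (simp add: frobenius_inner_def eqA eqB sum_product mult_ac)
  also have "\<dots> = (\<Sum>k=1..r. \<Sum>l=1..s. \<Sum>i<m. \<Sum>j<n.
      complex_of_real (\<sigma> k * \<tau> l) * ((u k i * cnj (x l i)) * (y l j * cnj (v k j))))"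
    by (simp only: sum.swap[of _ "{1..r}" "{..<n}"] sum.swap[of _ "{1..s}" "{..<n}"]
        sum.swap[of _ "{1..r}" "{..<m}"] sum.swap[of _ "{1..s}" "{..<m}"])
  also have "\<dots> = (\<Sum>k=1..r. \<Sum>l=1..s. complex_of_real (\<sigma> k * \<tau> l) *
      (cinner m (u k) (x l) * cinner n (y l) (v k)))"
    by (simp only: cinner_def sum_product) (simp only: sum_distrib_left)
  finally show ?thesis .
qed

text \<open>Expanding both matrices into singular dyads reduces this to the bound on products of overlaps. Only
  the real part enters the squared norm of a sum.\<close>

lemma von_neumann_trace_inequality:
  assumes A: "A \<in> carrier_mat m n" and B: "B \<in> carrier_mat m n" and "r \<le> s"
    and \<sigma>: "decreasing_positive r \<sigma>" and \<tau>: "decreasing_positive s \<tau>"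
    and svA: "has_nonzero_singular_values A r \<sigma>" and svB: "has_nonzero_singular_values B s \<tau>"
  shows "\<bar>Re (frobenius_inner A B)\<bar> \<le> G_sum r \<sigma> \<tau>"
proof -
  have pos: "\<And>k. k \<in> {1..r} \<Longrightarrow> 0 < \<sigma> k" "\<And>k. k \<in> {1..s} \<Longrightarrow> 0 < \<tau> k"
    using \<sigma> \<tau> by (auto simp: decreasing_positive_def)
  obtain u v where uv: "orthonormal_family m {1..r} u" "orthonormal_family n {1..r} v"
    and eqA: "\<And>i j. i < m \<Longrightarrow> j < n \<Longrightarrow>
      A $$ (i, j) = (\<Sum>k=1..r. complex_of_real (\<sigma> k) * u k i * cnj (v k j))"
    using singular_value_decomposition[OF A svA pos(1)] by blast
  obtain x y where xy: "orthonormal_family m {1..s} x" "orthonormal_family n {1..s} y"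
    and eqB: "\<And>i j. i < m \<Longrightarrow> j < n \<Longrightarrow>
      B $$ (i, j) = (\<Sum>l=1..s. complex_of_real (\<tau> l) * x l i * cnj (y l j))"
    using singular_value_decomposition[OF B svB pos(2)] by blast
  have expand: "frobenius_inner A B = (\<Sum>k=1..r. \<Sum>l=1..s. complex_of_real (\<sigma> k * \<tau> l) *
      (cinner m (u k) (x l) * cinner n (y l) (v k)))"
    by (rule frobenius_inner_dyads[OF A eqA eqB])
  have "\<bar>Re (frobenius_inner A B)\<bar> \<le> cmod (frobenius_inner A B)" by (rule abs_Re_le_cmod)
  also have "\<dots> \<le> G_sum r \<sigma> \<tau>"
    unfolding expand
    by (rule sum_product_overlaps_bound[OF \<sigma> \<tau> \<open>r \<le> s\<close> uv xy])
  finally show ?thesis .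
qed

lemma frobenius_norm_square_singular_values:
  assumes A: "A \<in> carrier_mat m n" and sv: "has_nonzero_singular_values A r \<sigma>"
    and pos: "\<And>k. k \<in> {1..r} \<Longrightarrow> 0 < \<sigma> k"
  shows "(frobenius_norm A)\<^sup>2 = (\<Sum>k=1..r. (\<sigma> k)\<^sup>2)"
proof -
  obtain u v where uv: "orthonormal_family m {1..r} u" "orthonormal_family n {1..r} v"
    and eqA: "\<And>i j. i < m \<Longrightarrow> j < n \<Longrightarrow>
      A $$ (i, j) = (\<Sum>k=1..r. complex_of_real (\<sigma> k) * u k i * cnj (v k j))"
    using singular_value_decomposition[OF A sv pos] by blast
  have "frobenius_inner A A = (\<Sum>k=1..r. \<Sum>l=1..r. complex_of_real (\<sigma> k * \<sigma> l) *
      (cinner m (u k) (u l) * cinner n (v l) (v k)))"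
    by (rule frobenius_inner_dyads[OF A eqA eqA])
  also have "\<dots> = (\<Sum>k=1..r. \<Sum>l=1..r. if l = k then complex_of_real ((\<sigma> k)\<^sup>2) else 0)"
    using uv by (intro sum.cong) (auto simp: orthonormal_family_def power2_eq_square)
  also have "\<dots> = complex_of_real (\<Sum>k=1..r. (\<sigma> k)\<^sup>2)"
    by (simp del: of_real_power)
  finally show ?thesis
    unfolding frobenius_norm_square[symmetric] of_real_eq_iff .
qed

section \<open>The polar factors\<close>

lemma column_range_eq:
  "A \<in> carrier_mat m n \<Longrightarrow> column_range A = {A *\<^sub>v x | x. x \<in> carrier_vec n}"
  unfolding column_range_def using vec_space.col_space_eq[of A m n] by auto

text \<open>\<open>Q\<close> is isometric on the column range of \<open>Q\<^sup>*\<close>, which is that of \<open>H\<close>; hence \<open>A x = Q (H x)\<close> and \<open>H x\<close>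
  have the same norm for every \<open>x\<close>, and \<open>A\<^sup>*A = H\<^sup>*H\<close>.\<close>

lemma polar_factor_singular_values:
  assumes "generalized_polar_decomposition r m n A Q H"
  shows "has_nonzero_singular_values H k \<sigma> \<longleftrightarrow> has_nonzero_singular_values A k \<sigma>"
proof -
  have A: "A \<in> carrier_mat m n" and Q: "Q \<in> carrier_mat m n" and H: "H \<in> carrier_mat n n"
    and AQH: "A = Q * H" and sub: "subunitary Q"
    and range: "column_range (mat_adjoint Q) = column_range H"
    using assms by (auto simp: generalized_polar_decomposition_def rank_mats_def)
  have "mat_adjoint A * A = mat_adjoint H * H"
  proof (rule gram_matrix_eqI[OF A H])
    fix x :: "complex vec" assume x: "x \<in> carrier_vec n"
    have "H *\<^sub>v x \<in> column_range (mat_adjoint Q)"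
      unfolding range column_range_eq[OF H] using x by auto
    then have "(Q *\<^sub>v (H *\<^sub>v x)) \<bullet>c (Q *\<^sub>v (H *\<^sub>v x)) = (H *\<^sub>v x) \<bullet>c (H *\<^sub>v x)"
      using sub by (auto simp: subunitary_def)
    then show "(A *\<^sub>v x) \<bullet>c (A *\<^sub>v x) = (H *\<^sub>v x) \<bullet>c (H *\<^sub>v x)"
      unfolding AQH using assoc_mult_mat_vec[OF Q H x] by simp
  qed
  then show ?thesis
    by (simp add: has_nonzero_singular_values_def nonzero_singular_values_def)
qed


section \<open>The case of equality\<close>

definition rect_diag :: "nat \<Rightarrow> nat \<Rightarrow> nat \<Rightarrow> (nat \<Rightarrow> real) \<Rightarrow> complex mat" where
  "rect_diag m n k d = mat m n (\<lambda>(i, j). if i = j \<and> i < k then complex_of_real (d i) else 0)"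

lemma rect_diag_carrier [simp]: "rect_diag m n k d \<in> carrier_mat m n"
  and rect_diag_dim [simp]: "dim_row (rect_diag m n k d) = m" "dim_col (rect_diag m n k d) = n"
  and rect_diag_index [simp]: "i < m \<Longrightarrow> j < n \<Longrightarrow>
    rect_diag m n k d $$ (i, j) = (if i = j \<and> i < k then complex_of_real (d i) else 0)"
  by (auto simp: rect_diag_def)

lemma rect_diag_adjoint [simp]: "mat_adjoint (rect_diag m n k d) = rect_diag n m k d"
  by (intro eq_matI) auto

lemma rect_diag_mult:
  assumes "k \<le> n"
  shows "rect_diag m n k d * rect_diag n p k e = rect_diag m p k (\<lambda>i. d i * e i)"
proof (rule eq_matI)
  fix i j
  assume "i < dim_row (rect_diag m p k (\<lambda>i. d i * e i))" "j < dim_col (rect_diag m p k (\<lambda>i. d i * e i))"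
  then have ij: "i < m" "j < p" by auto
  have "(rect_diag m n k d * rect_diag n p k e) $$ (i, j) =
      (\<Sum>l<n. rect_diag m n k d $$ (i, l) * rect_diag n p k e $$ (l, j))"
    using ij by (simp add: scalar_prod_def atLeast0LessThan)
  also have "\<dots> = (\<Sum>l<n. if l = i then (if i = j \<and> i < k then complex_of_real (d i * e i) else 0) else 0)"
    using ij by (intro sum.cong) auto
  also have "\<dots> = rect_diag m p k (\<lambda>i. d i * e i) $$ (i, j)"
    using ij assms by auto
  finally show "(rect_diag m n k d * rect_diag n p k e) $$ (i, j) =
    rect_diag m p k (\<lambda>i. d i * e i) $$ (i, j)" .
qed auto

lemma rect_diag_mult_vec:
  assumes "x \<in> carrier_vec n" "k \<le> n" "i < m"
  shows "(rect_diag m n k d *\<^sub>v x) $ i = (if i < k then complex_of_real (d i) * x $ i else 0)"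
proof -
  have "(rect_diag m n k d *\<^sub>v x) $ i = (\<Sum>l<n. rect_diag m n k d $$ (i, l) * x $ l)"
    using assms by (simp add: scalar_prod_def atLeast0LessThan)
  also have "\<dots> = (\<Sum>l<n. if l = i then (if i < k then complex_of_real (d i) * x $ i else 0) else 0)"
    using assms by (intro sum.cong) auto
  also have "\<dots> = (if i < k then complex_of_real (d i) * x $ i else 0)" using assms by auto
  finally show ?thesis .
qed

text \<open>The first \<open>k\<close> columns are independent, and all others are zero, so they form a maximal
  independent set of columns.\<close>

lemma rank_rect_diag:
  assumes k: "k \<le> m" "k \<le> n" and d: "\<And>i. i < k \<Longrightarrow> d i \<noteq> 0"
  shows "vec_space.rank m (rect_diag m n k d) = k"
proof -
  interpret vec_space "TYPE(complex)" m .
  let ?A = "rect_diag m n k d" and ?B = "rect_diag m k k d"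
  define S where "S = set (cols ?B)"
  have B: "?B \<in> carrier_mat m k" by simp
  have col_B: "col ?B i = col ?A i" if "i < k" for i
    using that k by (intro eq_vecI) auto
  have inj: "distinct (cols ?B)"
  proof (subst distinct_conv_nth, intro allI impI)
    fix i j assume ij: "i < length (cols ?B)" "j < length (cols ?B)" "i \<noteq> j"
    then have "col ?B i $ i \<noteq> col ?B j $ i" using d k by auto
    then show "cols ?B ! i \<noteq> cols ?B ! j" using ij by auto
  qed
  have indpt: "lin_indpt S"
  proof
    assume "lin_dep S"
    then obtain v where v: "v \<in> carrier_vec k" "v \<noteq> 0\<^sub>v k" "?B *\<^sub>v v = 0\<^sub>v m"
      using lin_depE[OF B _ inj] unfolding S_def by blast
    have "v $ i = 0" if "i < k" for i
      using rect_diag_mult_vec[OF v(1) order_refl, of i m d] that k d v(3) by auto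
    then have "v = 0\<^sub>v k" using v(1) by (intro eq_vecI) auto
    with v(2) show False by simp
  qed
  have card: "card S = k" unfolding S_def using distinct_card[OF inj] by simp
  have "S \<subseteq> set (cols ?A)"
    unfolding S_def using k col_B by (auto simp: cols_def)
  moreover have other: "set (cols ?A) \<subseteq> insert (0\<^sub>v m) S"
  proof
    fix w assume "w \<in> set (cols ?A)"
    then obtain j where j: "j < n" "w = col ?A j" by (auto simp: cols_def)
    show "w \<in> insert (0\<^sub>v m) S"
    proof (cases "j < k")
      case True
      then show ?thesis unfolding S_def j(2) col_B[OF True, symmetric] using True by (auto simp: cols_def)
    next
      case False
      then have "w = 0\<^sub>v m" using j by (intro eq_vecI) auto
      then show ?thesis by simp
    qed
  qed
  ultimately have "maximal S (\<lambda>T. T \<subseteq> set (cols ?A) \<and> lin_indpt T)"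
    unfolding maximal_def
  proof (intro conjI allI impI indpt)
    fix T assume T: "S \<subseteq> T \<and> T \<subseteq> set (cols ?A) \<and> lin_indpt T"
    have "T \<subseteq> carrier_vec m" using T cols_dim[of ?A] by auto
    moreover have "(UNIV :: complex set) \<noteq> {0}" by (metis UNIV_I singletonD zero_neq_one)
    ultimately have "0\<^sub>v m \<notin> T" using T zero_nin_lin_indpt[of T] by (simp add: class_field_def)
    with T other show "T = S" by auto
  qed auto
  then show ?thesis using rank_card_indpt[of ?A n S] card by simp
qed

lemma column_range_rect_diag:
  assumes k: "k \<le> m" "k \<le> n" and d: "\<And>i. i < k \<Longrightarrow> d i \<noteq> 0"
  shows "column_range (rect_diag m n k d) = {y \<in> carrier_vec m. \<forall>i. k \<le> i \<and> i < m \<longrightarrow> y $ i = 0}"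
proof (intro equalityI subsetI)
  fix y :: "complex vec" assume "y \<in> column_range (rect_diag m n k d)"
  then obtain x where x: "x \<in> carrier_vec n" "y = rect_diag m n k d *\<^sub>v x"
    unfolding column_range_eq[OF rect_diag_carrier] by blast
  then show "y \<in> {y \<in> carrier_vec m. \<forall>i. k \<le> i \<and> i < m \<longrightarrow> y $ i = 0}"
    using rect_diag_mult_vec[OF x(1) k(2), of _ m d] mult_mat_vec_carrier[OF rect_diag_carrier x(1)]
    by auto
next
  fix y :: "complex vec" assume y: "y \<in> {y \<in> carrier_vec m. \<forall>i. k \<le> i \<and> i < m \<longrightarrow> y $ i = 0}"
  define x where "x = vec n (\<lambda>i. if i < k then y $ i / complex_of_real (d i) else 0)"
  have x: "x \<in> carrier_vec n" by (simp add: x_def)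
  have "y = rect_diag m n k d *\<^sub>v x"
  proof (rule eq_vecI)
    fix i assume "i < dim_vec (rect_diag m n k d *\<^sub>v x)"
    then have "i < m" by simp
    then show "y $ i = (rect_diag m n k d *\<^sub>v x) $ i"
      unfolding rect_diag_mult_vec[OF x k(2) \<open>i < m\<close>] using y d k by (auto simp: x_def)
  qed (use y in auto)
  then show "y \<in> column_range (rect_diag m n k d)"
    unfolding column_range_eq[OF rect_diag_carrier] using x by blast
qed

lemma positive_semidefinite_rect_diag:
  assumes "k \<le> n" and "\<And>i. i < k \<Longrightarrow> 0 \<le> d i"
  shows "positive_semidefinite (rect_diag n n k d)"
  unfolding positive_semidefinite_def
proof (intro conjI ballI)
  fix x :: "complex vec" assume "x \<in> carrier_vec (dim_col (rect_diag n n k d))"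
  then have x: "x \<in> carrier_vec n" by simp
  have "(rect_diag n n k d *\<^sub>v x) \<bullet>c x = (\<Sum>i<n. (rect_diag n n k d *\<^sub>v x) $ i * cnj (x $ i))"
    using x by (simp add: scalar_prod_def atLeast0LessThan del: index_mult_mat_vec)
  also have "\<dots> = (\<Sum>i<n. complex_of_real (if i < k then d i * (cmod (x $ i))\<^sup>2 else 0))"
    using x assms(1)
    by (intro sum.cong) (auto simp: rect_diag_mult_vec complex_norm_square
        simp del: index_mult_mat_vec of_real_power)
  also have "0 \<le> \<dots>"
    using assms(2) by (intro sum_nonneg) (auto simp: less_eq_complex_def)
  finally show "0 \<le> (rect_diag n n k d *\<^sub>v x) \<bullet>c x" .
qed auto

text \<open>The sign \<open>c\<close> is absorbed by the subunitary factor, so the positive polar factor does not see it. This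
  is what lets \<open>A\<close> and \<open>A'\<close> point in opposite directions while \<open>H\<close> and \<open>H'\<close> are aligned.\<close>

lemma generalized_polar_decomposition_rect_diag:
  assumes k: "k \<le> m" "k \<le> n" and d: "\<And>i. i < k \<Longrightarrow> 0 < d i" and c: "c = 1 \<or> c = -1"
  shows "generalized_polar_decomposition k m n
    (rect_diag m n k (\<lambda>i. c * d i)) (rect_diag m n k (\<lambda>_. c)) (rect_diag n n k d)"
proof -
  have c0: "c \<noteq> 0" and d0: "\<And>i. i < k \<Longrightarrow> d i \<noteq> 0" using c d by force+
  have cd0: "\<And>i. i < k \<Longrightarrow> c * d i \<noteq> 0" using c0 d0 by simp
  have "subunitary (rect_diag m n k (\<lambda>_. c))"
    unfolding subunitary_def rect_diag_adjoint
  proof (rule ballI)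
    let ?Q = "rect_diag m n k (\<lambda>_. c)"
    fix x assume "x \<in> column_range (rect_diag n m k (\<lambda>_. c))"
    then have x: "x \<in> carrier_vec n" and x0: "\<And>i. k \<le> i \<Longrightarrow> i < n \<Longrightarrow> x $ i = 0"
      using column_range_rect_diag[of k n m "\<lambda>_. c"] k c0 by auto
    have "(?Q *\<^sub>v x) \<bullet>c (?Q *\<^sub>v x) = (\<Sum>i<m. (?Q *\<^sub>v x) $ i * cnj ((?Q *\<^sub>v x) $ i))"
      by (simp add: scalar_prod_def atLeast0LessThan del: index_mult_mat_vec)
    also have "\<dots> = (\<Sum>i<k. x $ i * cnj (x $ i))"
      using k c x by (intro sum.mono_neutral_cong_right)
        (auto simp: rect_diag_mult_vec simp del: index_mult_mat_vec)
    also have "\<dots> = (\<Sum>i<n. x $ i * cnj (x $ i))"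
      using k x0 by (intro sum.mono_neutral_left) auto
    also have "\<dots> = x \<bullet>c x" using x by (simp add: scalar_prod_def atLeast0LessThan)
    finally show "(?Q *\<^sub>v x) \<bullet>c (?Q *\<^sub>v x) = x \<bullet>c x" .
  qed
  moreover have "column_range (rect_diag n m k (\<lambda>_. c)) = column_range (rect_diag n n k d)"
    using k c0 d0 by (simp add: column_range_rect_diag)
  moreover have "positive_semidefinite (rect_diag n n k d)"
    using k d by (intro positive_semidefinite_rect_diag) (auto intro: less_imp_le)
  ultimately show ?thesis
    unfolding generalized_polar_decomposition_def rank_mats_def
    using k c0 d0 cd0 by (simp add: rank_rect_diag rect_diag_mult)
qed

lemma singular_values_rect_diag:
  assumes k: "k \<le> m" "k \<le> n" and \<sigma>: "\<And>j. j \<in> {1..k} \<Longrightarrow> 0 < \<sigma> j" and c: "c = 1 \<or> c = -1"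
  shows "has_nonzero_singular_values (rect_diag m n k (\<lambda>i. c * \<sigma> (Suc i))) k \<sigma>"
proof -
  let ?A = "rect_diag m n k (\<lambda>i. c * \<sigma> (Suc i))"
  define e where "e i = (if i < k then complex_of_real ((\<sigma> (Suc i))\<^sup>2) else 0)" for i
  have cc: "c * x * (c * x) = x\<^sup>2" for x using c by (auto simp: power2_eq_square)
  have G: "mat_adjoint ?A * ?A = rect_diag n n k (\<lambda>i. (\<sigma> (Suc i))\<^sup>2)"
    using k by (simp add: rect_diag_mult cc)
  have diag: "diag_mat (rect_diag n n k (\<lambda>i. (\<sigma> (Suc i))\<^sup>2)) = map e [0..<n]"
    by (auto simp: diag_mat_def e_def)
  have cp: "char_poly (mat_adjoint ?A * ?A) = (\<Prod>a\<leftarrow>map e [0..<n]. [:- a, 1:])"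
    unfolding G diag[symmetric]
    by (rule char_poly_upper_triangular[of _ n]) (auto simp: upper_triangular_def)
  have "filter_mset (\<lambda>z. z \<noteq> 0) (mset (map e [0..<n])) = mset (filter (\<lambda>z. z \<noteq> 0) (map e ([0..<k] @ [k..<n])))"
    using upt_add_eq_append[of 0 k "n - k"] k by (simp only: mset_filter) simp
  also have "filter (\<lambda>z. z \<noteq> 0) (map e ([0..<k] @ [k..<n])) = map e [0..<k]"
  proof -
    have "filter (\<lambda>z. z \<noteq> 0) (map e [0..<k]) = map e [0..<k]"
    proof (intro filter_True ballI)
      fix x assume "x \<in> set (map e [0..<k])"
      then obtain i where "i < k" "x = e i" by auto
      then show "x \<noteq> 0" using \<sigma>[of "Suc i"] by (simp add: e_def)
    qed
    moreover have "filter (\<lambda>z. z \<noteq> 0) (map e [k..<n]) = []"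
      by (intro filter_False) (auto simp: e_def)
    ultimately show ?thesis by (simp only: map_append filter_append) simp
  qed
  finally have F: "filter_mset (\<lambda>z. z \<noteq> 0) (mset (map e [0..<n])) = mset (map e [0..<k])" .
  have "nonzero_singular_values ?A = mset (map (\<lambda>z. sqrt (Re z)) (map e [0..<k]))"
    unfolding nonzero_singular_values_def cp proots_linear_factors F by (simp only: mset_map)
  also have "map (\<lambda>z. sqrt (Re z)) (map e [0..<k]) = map \<sigma> (map Suc [0..<k])"
    using \<sigma> by (auto simp: e_def less_imp_le)
  also have "mset \<dots> = image_mset \<sigma> (mset_set {1..k})"
    unfolding map_Suc_upt mset_map by (simp add: atLeastLessThanSuc_atLeastAtMost del: upt_Suc)
  finally show ?thesis by (simp add: has_nonzero_singular_values_def)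
qed

lemma frobenius_inner_rect_diag:
  assumes "r \<le> s" "s \<le> m" "s \<le> n"
  shows "frobenius_inner (rect_diag m n r d) (rect_diag m n s e) =
    complex_of_real (\<Sum>i<r. d i * e i)"
proof -
  have "frobenius_inner (rect_diag m n r d) (rect_diag m n s e) =
      (\<Sum>i<m. \<Sum>j<n. if j = i then (if i < r then complex_of_real (d i * e i) else 0) else 0)"
    unfolding frobenius_inner_def using assms by (intro sum.cong) auto
  also have "\<dots> = (\<Sum>i<m. if i < r then complex_of_real (d i * e i) else 0)"
    using assms by (intro sum.cong) auto
  also have "\<dots> = (\<Sum>i<r. complex_of_real (d i * e i))"
    using assms by (intro sum.mono_neutral_cong_right) auto
  finally show ?thesis by simp
qed

section \<open>The optimal inequality\<close>

lemma G_sum_bounds: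
  assumes "1 \<le> r" "r \<le> s" and \<sigma>: "decreasing_positive r \<sigma>" and \<tau>: "decreasing_positive s \<tau>"
  shows "0 < G_sum r \<sigma> \<tau>" and "2 * G_sum r \<sigma> \<tau> \<le> F_sum r s \<sigma> \<tau>"
proof -
  have pos: "\<And>k. k \<in> {1..r} \<Longrightarrow> 0 < \<sigma> k" "\<And>k. k \<in> {1..r} \<Longrightarrow> 0 < \<tau> k"
    using \<sigma> \<tau> \<open>r \<le> s\<close> by (auto simp: decreasing_positive_def)
  show "0 < G_sum r \<sigma> \<tau>"
    unfolding G_sum_def using pos \<open>1 \<le> r\<close> by (intro sum_pos) auto
  have "2 * G_sum r \<sigma> \<tau> = (\<Sum>j=1..r. 2 * \<sigma> j * \<tau> j)"
    by (simp add: G_sum_def sum_distrib_left mult.assoc)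
  also have "\<dots> \<le> (\<Sum>j=1..r. (\<sigma> j)\<^sup>2 + (\<tau> j)\<^sup>2)" by (intro sum_mono sum_squares_bound)
  also have "\<dots> = (\<Sum>j=1..r. (\<sigma> j)\<^sup>2) + (\<Sum>j=1..r. (\<tau> j)\<^sup>2)" by (rule sum.distrib)
  also have "\<dots> \<le> F_sum r s \<sigma> \<tau>"
    unfolding F_sum_def using \<open>r \<le> s\<close> by (intro add_left_mono sum_mono2) auto
  finally show "2 * G_sum r \<sigma> \<tau> \<le> F_sum r s \<sigma> \<tau>" .
qed

lemma frobenius_norm_nonneg: "0 \<le> frobenius_norm A"
  by (simp add: frobenius_norm_def sum_nonneg)

theorem theorem1p13:
  fixes m n r s :: nat and \<sigma> \<tau> :: "nat \<Rightarrow> real"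
  assumes "1 \<le> r" and "r \<le> s"
    and "decreasing_positive r \<sigma>" and "decreasing_positive s \<tau>"
  shows
    "(\<forall>A Q H A' Q' H'.
        A \<in> rank_mats r m n \<longrightarrow> A' \<in> rank_mats s m n \<longrightarrow>
        generalized_polar_decomposition r m n A Q H \<longrightarrow>
        generalized_polar_decomposition s m n A' Q' H' \<longrightarrow>
        has_nonzero_singular_values A r \<sigma> \<longrightarrow>
        has_nonzero_singular_values A' s \<tau> \<longrightarrow>
        frobenius_norm (A + A') \<ge> polar_coefficient r s \<sigma> \<tau> * frobenius_norm (H + H'))
     \<and>
     (s \<le> min m n \<longrightarrow>
        (\<forall>c > polar_coefficient r s \<sigma> \<tau>.
          \<not> (\<forall>A Q H A' Q' H'.
              A \<in> rank_mats r m n \<longrightarrow> A' \<in> rank_mats s m n \<longrightarrow>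
              generalized_polar_decomposition r m n A Q H \<longrightarrow>
              generalized_polar_decomposition s m n A' Q' H' \<longrightarrow>
              has_nonzero_singular_values A r \<sigma> \<longrightarrow>
              has_nonzero_singular_values A' s \<tau> \<longrightarrow>
              frobenius_norm (A + A') \<ge> c * frobenius_norm (H + H'))))"
proof -
  let ?F = "F_sum r s \<sigma> \<tau>" and ?G = "G_sum r \<sigma> \<tau>"
  note G_pos = G_sum_bounds(1)[OF assms] and GF = G_sum_bounds(2)[OF assms]
  have pos: "\<And>k. k \<in> {1..r} \<Longrightarrow> 0 < \<sigma> k" "\<And>k. k \<in> {1..s} \<Longrightarrow> 0 < \<tau> k"
    using assms by (auto simp: decreasing_positive_def)
  have coeff: "polar_coefficient r s \<sigma> \<tau> = sqrt (?F - 2 * ?G) / sqrt (?F + 2 * ?G)"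
    by (simp add: polar_coefficient_def real_sqrt_divide)
  have norm_add: "(frobenius_norm (B + B'))\<^sup>2 = ?F + 2 * Re (frobenius_inner B B')"
    if "B \<in> carrier_mat p q" "B' \<in> carrier_mat p q"
      "has_nonzero_singular_values B r \<sigma>" "has_nonzero_singular_values B' s \<tau>" for B B' p q
    using frobenius_norm_add_square[OF that(1,2)]
      frobenius_norm_square_singular_values[OF that(1,3) pos(1)]
      frobenius_norm_square_singular_values[OF that(2,4) pos(2)]
    by (simp add: F_sum_def)
  \<comment> \<open>The two norms are estimated separately, by \<open>F - 2G\<close> from below and \<open>F + 2G\<close> from above.\<close>
  have lower: "polar_coefficient r s \<sigma> \<tau> * frobenius_norm (H + H') \<le> frobenius_norm (A + A')"
    if pd: "generalized_polar_decomposition r m n A Q H"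
      "generalized_polar_decomposition s m n A' Q' H'"
      and sv: "has_nonzero_singular_values A r \<sigma>" "has_nonzero_singular_values A' s \<tau>"
    for A Q H A' Q' H'
  proof -
    have carrier: "A \<in> carrier_mat m n" "A' \<in> carrier_mat m n" "H \<in> carrier_mat n n" "H' \<in> carrier_mat n n"
      using pd by (auto simp: generalized_polar_decomposition_def rank_mats_def)
    have svH: "has_nonzero_singular_values H r \<sigma>" "has_nonzero_singular_values H' s \<tau>"
      using sv by (simp_all add: polar_factor_singular_values[OF pd(1)] polar_factor_singular_values[OF pd(2)])
    have "?F - 2 * ?G \<le> (frobenius_norm (A + A'))\<^sup>2"
      using norm_add[OF carrier(1,2) sv]
        von_neumann_trace_inequality[OF carrier(1,2) assms(2-4) sv] by simp
    then have "sqrt (?F - 2 * ?G) \<le> frobenius_norm (A + A')"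
      using frobenius_norm_nonneg by (intro real_le_lsqrt) auto
    moreover have "(frobenius_norm (H + H'))\<^sup>2 \<le> ?F + 2 * ?G"
      using norm_add[OF carrier(3,4) svH]
        von_neumann_trace_inequality[OF carrier(3,4) assms(2-4) svH] by simp
    then have "frobenius_norm (H + H') \<le> sqrt (?F + 2 * ?G)" by (rule real_le_rsqrt)
    then have "frobenius_norm (H + H') / sqrt (?F + 2 * ?G) \<le> 1"
      using G_pos GF by simp
    then have "sqrt (?F - 2 * ?G) * (frobenius_norm (H + H') / sqrt (?F + 2 * ?G)) \<le> sqrt (?F - 2 * ?G)"
      using GF by (intro mult_left_le) auto
    ultimately show ?thesis by (simp add: coeff)
  qed
  have sharp: "\<exists>A Q H A' Q' H'. A \<in> rank_mats r m n \<and> A' \<in> rank_mats s m n \<and>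
      generalized_polar_decomposition r m n A Q H \<and>
      generalized_polar_decomposition s m n A' Q' H' \<and>
      has_nonzero_singular_values A r \<sigma> \<and> has_nonzero_singular_values A' s \<tau> \<and>
      frobenius_norm (A + A') < c * frobenius_norm (H + H')"
    if s: "s \<le> min m n" and c: "polar_coefficient r s \<sigma> \<tau> < c" for c
  proof -
    \<comment> \<open>The factor 1 matches the sign \<open>c\<close> of the diagonal polar decomposition.\<close>
    define A where "A = rect_diag m n r (\<lambda>i. 1 * \<sigma> (Suc i))"
    define H where "H = rect_diag n n r (\<lambda>i. \<sigma> (Suc i))"
    define A' where "A' = rect_diag m n s (\<lambda>i. -1 * \<tau> (Suc i))"
    define H' where "H' = rect_diag n n s (\<lambda>i. \<tau> (Suc i))"
    have pd: "generalized_polar_decomposition r m n A (rect_diag m n r (\<lambda>_. 1)) H"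
      "generalized_polar_decomposition s m n A' (rect_diag m n s (\<lambda>_. -1)) H'"
      unfolding A_def H_def A'_def H'_def
      by (rule generalized_polar_decomposition_rect_diag; use s \<open>r \<le> s\<close> pos in simp)+
    have sv: "has_nonzero_singular_values A r \<sigma>" "has_nonzero_singular_values A' s \<tau>"
      unfolding A_def A'_def
      by (rule singular_values_rect_diag; use s \<open>r \<le> s\<close> pos in simp)+
    have svH: "has_nonzero_singular_values H r \<sigma>" "has_nonzero_singular_values H' s \<tau>"
      using sv by (simp_all add: polar_factor_singular_values[OF pd(1)] polar_factor_singular_values[OF pd(2)])
    have G: "(\<Sum>i<r. \<sigma> (Suc i) * \<tau> (Suc i)) = ?G"
      unfolding G_sum_def by (rule sum.reindex_bij_witness[of _ "\<lambda>k. k - 1" Suc]) auto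
    have "(frobenius_norm (A + A'))\<^sup>2 = ?F - 2 * ?G"
      using norm_add[OF _ _ sv, of m n] s \<open>r \<le> s\<close> G
      by (simp add: A_def A'_def frobenius_inner_rect_diag sum_negf del: of_real_mult of_real_sum)
    then have AA: "frobenius_norm (A + A') = sqrt (?F - 2 * ?G)"
      using frobenius_norm_nonneg by (metis real_sqrt_unique)
    have "(frobenius_norm (H + H'))\<^sup>2 = ?F + 2 * ?G"
      using norm_add[OF _ _ svH, of n n] s \<open>r \<le> s\<close> G
      by (simp add: H_def H'_def frobenius_inner_rect_diag del: of_real_mult of_real_sum)
    then have HH: "frobenius_norm (H + H') = sqrt (?F + 2 * ?G)"
      using frobenius_norm_nonneg by (metis real_sqrt_unique)
    have "0 < sqrt (?F + 2 * ?G)" using G_pos GF by simp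
    then have "frobenius_norm (A + A') < c * frobenius_norm (H + H')"
      using c unfolding coeff AA HH by (simp add: pos_divide_less_eq)
    moreover have "A \<in> rank_mats r m n" "A' \<in> rank_mats s m n"
      using pd by (auto simp: generalized_polar_decomposition_def)
    ultimately show ?thesis using pd sv by blast
  qed
  show ?thesis
  proof (intro conjI allI impI)
    fix c assume "s \<le> min m n" and "polar_coefficient r s \<sigma> \<tau> < c"
    from sharp[OF this] show "\<not> (\<forall>A Q H A' Q' H'.
              A \<in> rank_mats r m n \<longrightarrow> A' \<in> rank_mats s m n \<longrightarrow>
              generalized_polar_decomposition r m n A Q H \<longrightarrow>
              generalized_polar_decomposition s m n A' Q' H' \<longrightarrow>
              has_nonzero_singular_values A r \<sigma> \<longrightarrow>
              has_nonzero_singular_values A' s \<tau> \<longrightarrow>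
              frobenius_norm (A + A') \<ge> c * frobenius_norm (H + H'))"
      by (meson not_le)
  qed (rule lower)
qed

end
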